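(* Let $G$ be a signed digraph. If $G$ is non-separating and has feedback number $2$, then $H_2$ is embedded in $G$.
   Context: A signed digraph $G=(V,E)$ has finite vertex set $V$ and arcs $E\subseteq V\times V\times\{-1,1\}$ ($(j,i,s)$: arc from $j$ to $i$ of sign $s$; loops and opposite-sign parallel arcs allowed). Cycles and paths are simple subgraphs; sign = product of arc signs. The feedback number of $G$ is the minimum size of a set $I\subseteq V$ such that $G\setminus I$ has no cycle. A BN on $V$ is $f:\{0,1\}^V\to\{0,1\}^V$; $G(f)$ has a positive (negative) arc from $j$ to $i$ iff for some $x$ with $x_j=0$, $f_i(x+e_j)-f_i(x)$ is positive (negative) ($e_j$ = configuration equal to $1$ only at $j$, $+$ mod 2). $F(G)=\{f:G(f)=G\}$. $\Gamma(f)$ is the digraph on $\{0,1\}^V$ with arcs $x\to x+e_i$ whenever $f_i(x)\neq x_i$; attractors are inclusion-minimal nonempty sets with no outgoing arc. A subspace is $\{x:x_i=c(i)\ \forall i\in I\}$; $[X]$ is the smallest subspace containing $X$. $G$ is separating if for all $f\in F(G)$ and distinct attractors $A,B$ of $\Gamma(f)$, $[A]\cap[B]=\emptyset$; non-separating otherwise. $H_2$ is the signed digraph with vertex set $\{1,2\}$ whose arcs are: a positive and a negative loop on $1$, a positive loop on $2$, a positive and a negative arc from $1$ to $2$, and a positive and a negative arc from $2$ to $1$ (no negative loop on $2$). A signed digraph $H$ with vertex set $U$ is embedded in $G$ if there is an injection $\phi:U\to V$ such that for every positive (negative) arc of $H$ from $j$ to $i$, $G$ contains a positive (negative) path from $\phi(j)$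 to $\phi(i)$ whose internal vertices are not in $\phi(U)$; for a loop on $j$ this means a positive (negative) cycle of $G$ through $\phi(j)$ whose other vertices are not in $\phi(U)$. *)

theory Defs
  imports Complex_Main "HOL-Library.FuncSet" "Graph_Theory.Graph_Theory"
begin

section \<open>Signed digraphs\<close>

record 'v signed_graph =
  vertices :: "'v set"
  sarcs :: "('v \<times> 'v \<times> int) set"

definition signed_digraph :: "'v signed_graph \<Rightarrow> bool" where
  "signed_digraph G \<longleftrightarrow>
     finite (vertices G) \<and> sarcs G \<subseteq> vertices G \<times> vertices G \<times> {-1, 1}"

text \<open>The underlying multi-digraph; the signed arc itself serves as the arc identity, so that
  parallel arcs of opposite sign remain distinct arcs.\<close>

definition digraph_of :: "'v signed_graph \<Rightarrow> ('v, 'v \<times> 'v \<times> int) pre_digraph" where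
  "digraph_of G = \<lparr> verts = vertices G, arcs = sarcs G, tail = fst, head = fst \<circ> snd \<rparr>"

definition walk_sign :: "('v \<times> 'v \<times> int) list \<Rightarrow> int" where
  "walk_sign p = prod_list (map (snd \<circ> snd) p)"

definition feedback_vertex_set :: "'v signed_graph \<Rightarrow> 'v set \<Rightarrow> bool" where
  "feedback_vertex_set G I \<longleftrightarrow>
     I \<subseteq> vertices G \<and> (\<nexists>p. pre_digraph.cycle (digraph_of G \<restriction> (vertices G - I)) p)"

definition feedback_number :: "'v signed_graph \<Rightarrow> nat" where
  "feedback_number G = (LEAST k. \<exists>I. feedback_vertex_set G I \<and> card I = k)"


section \<open>Boolean networks\<close>

definition configs :: "'v set \<Rightarrow> ('v \<Rightarrow> int) set" where
  "configs V = V \<rightarrow>\<^sub>E {0, 1}"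

text \<open>The configuration $x + e_i$, with addition modulo 2.\<close>

definition flip :: "('v \<Rightarrow> int) \<Rightarrow> 'v \<Rightarrow> ('v \<Rightarrow> int)" where
  "flip x i = x(i := (x i + 1) mod 2)"

definition boolean_networks :: "'v set \<Rightarrow> (('v \<Rightarrow> int) \<Rightarrow> ('v \<Rightarrow> int)) set" where
  "boolean_networks V = configs V \<rightarrow>\<^sub>E configs V"

definition interaction_graph ::
    "'v set \<Rightarrow> (('v \<Rightarrow> int) \<Rightarrow> ('v \<Rightarrow> int)) \<Rightarrow> 'v signed_graph" where
  "interaction_graph V f =
     \<lparr> vertices = V,
       sarcs = {(j, i, 1) | j i. j \<in> V \<and> i \<in> V \<and>
                  (\<exists>x \<in> configs V. x j = 0 \<and> f (flip x j) i - f x i > 0)}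
             \<union> {(j, i, -1) | j i. j \<in> V \<and> i \<in> V \<and>
                  (\<exists>x \<in> configs V. x j = 0 \<and> f (flip x j) i - f x i < 0)} \<rparr>"

definition networks_on :: "'v signed_graph \<Rightarrow> (('v \<Rightarrow> int) \<Rightarrow> ('v \<Rightarrow> int)) set" where
  "networks_on G =
     {f \<in> boolean_networks (vertices G). interaction_graph (vertices G) f = G}"

definition async_arcs ::
    "'v set \<Rightarrow> (('v \<Rightarrow> int) \<Rightarrow> ('v \<Rightarrow> int)) \<Rightarrow> (('v \<Rightarrow> int) \<times> ('v \<Rightarrow> int)) set" where
  "async_arcs V f = {(x, flip x i) | x i. x \<in> configs V \<and> i \<in> V \<and> f x i \<noteq> x i}"

definition trap_set ::
    "'v set \<Rightarrow> (('v \<Rightarrow> int) \<Rightarrow> ('v \<Rightarrow> int)) \<Rightarrow> ('v \<Rightarrow> int) set \<Rightarrow> bool" where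
  "trap_set V f A \<longleftrightarrow> A \<subseteq> configs V \<and> (\<forall>(x, y) \<in> async_arcs V f. x \<in> A \<longrightarrow> y \<in> A)"

definition attractor ::
    "'v set \<Rightarrow> (('v \<Rightarrow> int) \<Rightarrow> ('v \<Rightarrow> int)) \<Rightarrow> ('v \<Rightarrow> int) set \<Rightarrow> bool" where
  "attractor V f A \<longleftrightarrow>
     A \<noteq> {} \<and> trap_set V f A \<and> (\<forall>B. B \<noteq> {} \<and> trap_set V f B \<and> B \<subseteq> A \<longrightarrow> B = A)"

definition is_subspace :: "'v set \<Rightarrow> ('v \<Rightarrow> int) set \<Rightarrow> bool" where
  "is_subspace V S \<longleftrightarrow>
     (\<exists>I c. I \<subseteq> V \<and> c \<in> I \<rightarrow> {0, 1} \<and> S = {x \<in> configs V. \<forall>i \<in> I. x i = c i})"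

definition subspace_hull :: "'v set \<Rightarrow> ('v \<Rightarrow> int) set \<Rightarrow> ('v \<Rightarrow> int) set" where
  "subspace_hull V X = is_subspace V hull X"

text \<open>Subspaces are nonempty, hence not closed under arbitrary intersection; for nonempty \<open>X\<close>
  the hull is nevertheless the smallest subspace containing \<open>X\<close>.\<close>

lemma is_subspace_subspace_hull:
  assumes "X \<noteq> {}" "X \<subseteq> configs V"
  shows "is_subspace V (subspace_hull V X)"
proof -
  obtain a where a: "a \<in> X" using assms(1) by blast
  define I where "I = {i \<in> V. \<forall>y \<in> X. y i = a i}"
  define S where "S = {x \<in> configs V. \<forall>i \<in> I. x i = a i}"
  have "a \<in> I \<rightarrow> {0, 1}"
  proof
    fix i assume "i \<in> I"
    then have "i \<in> V" by (simp add: I_def)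
    moreover have "a \<in> V \<rightarrow>\<^sub>E {0, 1}" using a assms(2) unfolding configs_def by blast
    ultimately show "a i \<in> {0, 1}" by (rule PiE_mem[rotated])
  qed
  moreover have "I \<subseteq> V" unfolding I_def by blast
  ultimately have S: "is_subspace V S"
    unfolding is_subspace_def S_def by (intro exI[of _ I] exI[of _ a] conjI refl)
  have "is_subspace V hull X = S"
  proof (rule hull_unique)
    show "X \<subseteq> S" using assms(2) unfolding S_def I_def by blast
    show "is_subspace V S" by (rule S)
  next
    fix T assume XT: "X \<subseteq> T" and "is_subspace V T"
    then obtain J c where J: "J \<subseteq> V" "T = {x \<in> configs V. \<forall>i \<in> J. x i = c i}"
      unfolding is_subspace_def by blast
    have Xc: "y i = c i" if "y \<in> X" "i \<in> J" for y i using that XT J(2) by blast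
    have Ji: "i \<in> I" if "i \<in> J" for i
    proof -
      have "i \<in> V" using that J(1) by blast
      moreover have "\<forall>y \<in> X. y i = a i"
      proof
        fix y assume "y \<in> X"
        then show "y i = a i" by (rule Xc[OF _ that, THEN trans]) (rule Xc[OF a that, symmetric])
      qed
      ultimately show ?thesis unfolding I_def by (intro CollectI conjI)
    qed
    show "S \<subseteq> T"
    proof
      fix x assume x: "x \<in> S"
      have "x i = c i" if "i \<in> J" for i
      proof -
        have "x i = a i" using x Ji[OF that] unfolding S_def by blast
        then show ?thesis by (rule trans) (rule Xc[OF a that])
      qed
      with x show "x \<in> T" unfolding S_def J(2) by blast
    qed
  qed
  with S show ?thesis by (simp add: subspace_hull_def)
qed

definition separating :: "'v signed_graph \<Rightarrow> bool" where
  "separating G \<longleftrightarrow>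
     (\<forall>f \<in> networks_on G. \<forall>A B.
        attractor (vertices G) f A \<and> attractor (vertices G) f B \<and> A \<noteq> B \<longrightarrow>
        subspace_hull (vertices G) A \<inter> subspace_hull (vertices G) B = {})"


section \<open>Embeddings\<close>

text \<open>The vertices of a cycle are the tails of its arcs, so the last two conjuncts of
  \<open>linking_cycle\<close> say that \<open>p\<close> passes through \<open>u\<close> and otherwise avoids \<open>W\<close>. Note that
  \<open>apath u p v\<close> with \<open>u \<noteq> v\<close> forces \<open>p\<close> to be nonempty.\<close>

definition linking_path ::
    "'v signed_graph \<Rightarrow> 'v set \<Rightarrow> 'v \<Rightarrow> ('v \<times> 'v \<times> int) list \<Rightarrow> 'v \<Rightarrow> bool" where
  "linking_path G W u p v \<longleftrightarrow>
     pre_digraph.apath (digraph_of G) u p v \<and>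
     (set (pre_digraph.awalk_verts (digraph_of G) u p) - {u, v}) \<inter> W = {}"

definition linking_cycle ::
    "'v signed_graph \<Rightarrow> 'v set \<Rightarrow> 'v \<Rightarrow> ('v \<times> 'v \<times> int) list \<Rightarrow> bool" where
  "linking_cycle G W u p \<longleftrightarrow>
     pre_digraph.cycle (digraph_of G) p \<and>
     u \<in> fst ` set p \<and> (fst ` set p - {u}) \<inter> W = {}"

definition embedded :: "'u signed_graph \<Rightarrow> 'v signed_graph \<Rightarrow> bool" where
  "embedded H G \<longleftrightarrow>
     (\<exists>\<phi>. inj_on \<phi> (vertices H) \<and> \<phi> ` vertices H \<subseteq> vertices G \<and>
        (\<forall>(j, i, s) \<in> sarcs H.
           if j = i
           then \<exists>p. linking_cycle G (\<phi> ` vertices H) (\<phi> j) p \<and> walk_sign p = s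
           else \<exists>p. linking_path G (\<phi> ` vertices H) (\<phi> j) p (\<phi> i) \<and> walk_sign p = s))"

definition H2 :: "nat signed_graph" where
  "H2 = \<lparr> vertices = {1, 2},
          sarcs = {(1, 1, 1), (1, 1, -1), (2, 2, 1),
                   (1, 2, 1), (1, 2, -1), (2, 1, 1), (2, 1, -1)} \<rparr>"

end

theory Submission
  imports Defs
begin

text \<open>Let \<open>I = {a, b}\<close> be a feedback vertex set. As \<open>G\<close> minus \<open>I\<close> is acyclic, every configuration
  can be driven, without updating \<open>a\<close> and \<open>b\<close>, to the unique configuration with the same values on
  \<open>I\<close> that is stable outside \<open>I\<close>. Hence distinct attractors have disjoint projections on \<open>{a, b}\<close>,
  and if their hulls meet, then one of them is a fixed point \<open>u\<close> and the other one, \<open>B\<close>, contains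
  configurations that differ from \<open>u\<close> on \<open>I\<close> only in \<open>a\<close>, respectively only in \<open>b\<close>. Whenever a
  perturbation of \<open>j \<in> I\<close> that spreads outside \<open>I\<close> ends up changing the image of \<open>i \<in> I\<close>, it has
  travelled from \<open>j\<close> to \<open>i\<close> along a path or cycle avoiding the rest of \<open>I\<close>, whose sign is dictated by
  the two changes. Comparing \<open>u\<close> with stable configurations of \<open>B\<close> gives both positive loops and one
  sign in each direction between \<open>a\<close> and \<open>b\<close>. The other sign from \<open>a\<close> to \<open>b\<close> arises since \<open>B\<close> has to
  leave the edge where \<open>a\<close> agrees with \<open>u\<close>, and the opposite corner thus reached is not a fixed point
  either, which gives a negative loop.\<close>

section \<open>Configurations and subspaces\<close>

lemma configs_values: "x \<in> configs V \<Longrightarrow> k \<in> V \<Longrightarrow> x k = 0 \<or> x k = 1"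
  unfolding configs_def by (auto dest: PiE_mem)

lemma configs_eqI:
  assumes "x \<in> configs V" "y \<in> configs V" "\<And>k. k \<in> V \<Longrightarrow> x k = y k"
  shows "x = y"
  using assms unfolding configs_def by (rule PiE_ext)

lemma configs_fun_upd: "x \<in> configs V \<Longrightarrow> k \<in> V \<Longrightarrow> c = 0 \<or> c = 1 \<Longrightarrow> x(k := c) \<in> configs V"
  unfolding configs_def by (auto simp: PiE_iff extensional_def)

lemma configs_override_on:
  assumes "x \<in> configs V" "y \<in> configs V"
  shows "override_on x y D \<in> configs V"
  using assms unfolding configs_def override_on_def by (auto simp: PiE_iff extensional_def)

lemma flip_eq_fun_upd:
  assumes "x k = 0 \<or> x k = 1" "c = 0 \<or> c = 1" "c \<noteq> x k"
  shows "flip x k = x(k := c)"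
  using assms by (auto simp: flip_def)

text \<open>The sign \<open>(-1)\<^sup>c\<close> of a Boolean value, which is also the only change that the value can
  undergo.\<close>

definition spin :: "int \<Rightarrow> int" where
  "spin c = 1 - 2 * c"

lemma configs_spin_values: "x \<in> configs V \<Longrightarrow> k \<in> V \<Longrightarrow> spin (x k) \<in> {1, -1}"
  using configs_values[of x V k] by (auto simp: spin_def)

lemma configs_spin_square:
  assumes "x \<in> configs V" "k \<in> V"
  shows "spin (x k) * spin (x k) = 1"
  using configs_spin_values[OF assms] by auto

lemma configs_spin_neq:
  assumes "x \<in> configs V" "y \<in> configs V" "k \<in> V" "x k \<noteq> y k"
  shows "spin (x k) = - spin (y k)"
  using configs_values[OF assms(1,3)] configs_values[OF assms(2,3)] assms(4)
  by (auto simp: spin_def)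

lemma configs_neq_neq_imp_eq:
  assumes "x \<in> configs V" "y \<in> configs V" "z \<in> configs V" "k \<in> V" "x k \<noteq> y k" "y k \<noteq> z k"
  shows "x k = z k"
  using assms(5,6) configs_values[OF assms(1,4)] configs_values[OF assms(2,4)]
    configs_values[OF assms(3,4)] by auto

lemma subspace_hull_subset_configs:
  assumes "X \<subseteq> configs V"
  shows "subspace_hull V X \<subseteq> configs V"
proof -
  have "is_subspace V (configs V)"
    unfolding is_subspace_def by (intro exI[of _ "{}"]) auto
  then show ?thesis using assms unfolding subspace_hull_def by (intro hull_minimal)
qed

lemma subspace_hull_coordinate:
  assumes X: "X \<noteq> {}" "X \<subseteq> configs V" and z: "z \<in> subspace_hull V X" and i: "i \<in> V"
  shows "\<exists>x \<in> X. x i = z i"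
proof (rule ccontr)
  assume none: "\<not> (\<exists>x \<in> X. x i = z i)"
  obtain w where w: "w \<in> X" using X(1) by blast
  define S where "S = {x \<in> configs V. \<forall>l \<in> {i}. x l = w l}"
  have zV: "z \<in> configs V" using z subspace_hull_subset_configs[OF X(2)] by blast
  have "w i \<in> {0, 1}" using configs_values[of w V i] w X(2) i by auto
  then have "is_subspace V S"
    unfolding is_subspace_def S_def using i by (intro exI[of _ "{i}"] exI[of _ w]) auto
  moreover have "X \<subseteq> S"
  proof
    fix x assume x: "x \<in> X"
    then have "x i = w i"
      using none w X(2) by (intro configs_neq_neq_imp_eq[OF _ zV _ i]) auto
    then show "x \<in> S" using x X(2) unfolding S_def by auto
  qed
  ultimately have "subspace_hull V X \<subseteq> S" unfolding subspace_hull_def by (intro hull_minimal)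
  then have "w i = z i" using z unfolding S_def by auto
  then show False using none w by blast
qed

lemma subspace_hulls_meet_coordinate:
  assumes "X \<noteq> {}" "X \<subseteq> configs V" "Y \<noteq> {}" "Y \<subseteq> configs V"
    and "subspace_hull V X \<inter> subspace_hull V Y \<noteq> {}" and "i \<in> V"
  shows "\<exists>x \<in> X. \<exists>y \<in> Y. x i = y i"
  using assms subspace_hull_coordinate by (metis disjoint_iff)

section \<open>Attractors\<close>

lemma attractor_minimal:
  assumes "attractor V f A" "trap_set V f B" "B \<noteq> {}" "B \<subseteq> A"
  shows "B = A"
  using assms by (simp add: attractor_def)

lemma attractor_subset_configs: "attractor V f A \<Longrightarrow> A \<subseteq> configs V"
  by (simp add: attractor_def trap_set_def)

lemma attractors_disjoint:
  assumes "attractor V f A" "attractor V f B" "A \<noteq> B"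
  shows "A \<inter> B = {}"
proof (rule ccontr)
  assume ne: "A \<inter> B \<noteq> {}"
  have "trap_set V f (A \<inter> B)"
    using assms(1,2) unfolding attractor_def trap_set_def by fastforce
  then have "A \<inter> B = A" "A \<inter> B = B"
    using attractor_minimal[OF assms(1) _ ne] attractor_minimal[OF assms(2) _ ne] by blast+
  with assms(3) show False by auto
qed

lemma attractor_fixed_point:
  assumes A: "attractor V f A" and x: "x \<in> A" and fixed: "\<And>i. i \<in> V \<Longrightarrow> f x i = x i"
  shows "A = {x}"
proof -
  have "trap_set V f {x}"
    using attractor_subset_configs[OF A] x fixed unfolding trap_set_def async_arcs_def by auto
  then show ?thesis using attractor_minimal[OF A, of "{x}"] x by simp
qed

locale boolean_network =
  fixes G :: "'v signed_graph" and f :: "('v \<Rightarrow> int) \<Rightarrow> ('v \<Rightarrow> int)"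
  assumes network: "f \<in> networks_on G"
begin

abbreviation V :: "'v set" where "V \<equiv> vertices G"

lemma network_configs: "x \<in> configs V \<Longrightarrow> f x \<in> configs V"
  using network unfolding networks_on_def boolean_networks_def by (auto dest: PiE_mem)

lemma network_values: "x \<in> configs V \<Longrightarrow> i \<in> V \<Longrightarrow> f x i = 0 \<or> f x i = 1"
  by (rule configs_values[OF network_configs])

lemma flip_eq_update:
  "x \<in> configs V \<Longrightarrow> k \<in> V \<Longrightarrow> f x k \<noteq> x k \<Longrightarrow> flip x k = x(k := f x k)"
  by (intro flip_eq_fun_upd configs_values network_values)

lemma trap_set_iff_update:
  "trap_set V f A \<longleftrightarrow> A \<subseteq> configs V \<and> (\<forall>x \<in> A. \<forall>k \<in> V. x(k := f x k) \<in> A)"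
proof (cases "A \<subseteq> configs V")
  case True
  have "(f x k \<noteq> x k \<longrightarrow> flip x k \<in> A) \<longleftrightarrow> x(k := f x k) \<in> A" if "x \<in> A" "k \<in> V" for x k
    using flip_eq_update[of x k] True that by (cases "f x k = x k") auto
  then show ?thesis using True unfolding trap_set_def async_arcs_def by blast
qed (simp add: trap_set_def)

lemma attractor_update:
  "attractor V f A \<Longrightarrow> x \<in> A \<Longrightarrow> k \<in> V \<Longrightarrow> x(k := f x k) \<in> A"
  by (simp add: attractor_def trap_set_iff_update)

lemma flip_changes_imp_arc:
  assumes x: "x \<in> configs V" "x k = 0" and V: "k \<in> V" "i \<in> V" and neq: "f (flip x k) i \<noteq> f x i"
  shows "(k, i, spin (f x i)) \<in> sarcs G"
proof -
  have "flip x k \<in> configs V"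
    using flip_eq_fun_upd[of x k 1] configs_fun_upd[OF x(1) V(1), of 1] x(2) by simp
  then consider "f (flip x k) i - f x i = 1" "spin (f x i) = 1"
    | "f (flip x k) i - f x i = -1" "spin (f x i) = -1"
    using network_values[of "flip x k" i] network_values[of x i] x(1) V(2) neq
    by (auto simp: spin_def)
  moreover have "sarcs G = sarcs (interaction_graph V f)"
    using network by (simp add: networks_on_def)
  ultimately show ?thesis using x V unfolding interaction_graph_def by cases force+
qed

lemma fun_upd_changes_imp_arc:
  assumes x: "x \<in> configs V" and V: "k \<in> V" "i \<in> V" and binary: "c = 0 \<or> c = 1"
    and neq: "f (x(k := c)) i \<noteq> f x i"
  shows "(k, i, spin (x k) * spin (f x i)) \<in> sarcs G"
proof -
  let ?y = "x(k := c)"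
  have y: "?y \<in> configs V" using x V(1) binary by (rule configs_fun_upd)
  have xk: "x k = 0 \<or> x k = 1" using x V(1) by (rule configs_values)
  have "c \<noteq> x k" using neq by auto
  then consider (set) "x k = 0" "flip x k = ?y" | (reset) "x k = 1" "c = 0" "flip ?y k = x"
    using xk binary flip_eq_fun_upd[of x k c] flip_eq_fun_upd[of ?y k "x k"] by auto
  then show ?thesis
  proof cases
    case set
    then show ?thesis using flip_changes_imp_arc[OF x _ V] neq by (simp add: spin_def)
  next
    case reset
    then have "(k, i, spin (f ?y i)) \<in> sarcs G" using flip_changes_imp_arc[OF y _ V] neq by simp
    moreover have "spin (f ?y i) = - spin (f x i)"
      using configs_spin_neq[OF network_configs[OF y] network_configs[OF x] V(2) neq] .
    moreover have "spin (x k) = -1" using reset(1) by (simp add: spin_def)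
    ultimately show ?thesis by simp
  qed
qed

lemma override_on_changes_imp_arc:
  assumes x: "x \<in> configs V" and y: "y \<in> configs V" and i: "i \<in> V"
    and "finite D" "D \<subseteq> V" "f (override_on x y D) i \<noteq> f x i"
  shows "\<exists>k \<in> D. y k \<noteq> x k \<and> (k, i, spin (x k) * spin (f x i)) \<in> sarcs G"
  using assms(4-6)
proof (induction D)
  case empty
  then show ?case by simp
next
  case (insert k D)
  let ?z = "override_on x y D"
  show ?case
  proof (cases "f ?z i = f x i")
    case True
    have zk: "?z k = x k" using insert.hyps(2) by simp
    have k: "k \<in> V" using insert.prems(1) by simp
    have neq: "f (?z(k := y k)) i \<noteq> f ?z i"
      using insert.prems(2) unfolding override_on_insert True .
    then have "y k \<noteq> x k" using zk by (metis fun_upd_triv)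
    then show ?thesis
      using fun_upd_changes_imp_arc[OF configs_override_on[OF x y] k i configs_values[OF y k] neq]
      unfolding zk True by blast
  next
    case False
    then show ?thesis using insert.IH insert.prems(1) by blast
  qed
qed

lemma changes_imp_arc:
  assumes "finite V" "x \<in> configs V" "y \<in> configs V" "i \<in> V" "f y i \<noteq> f x i"
  shows "\<exists>k \<in> V. y k \<noteq> x k \<and> (k, i, spin (x k) * spin (f x i)) \<in> sarcs G"
proof -
  have "override_on x y V = y"
    using configs_override_on[OF assms(2,3)] assms(3) by (rule configs_eqI) simp
  then show ?thesis using override_on_changes_imp_arc[OF assms(2-4), of V] assms(1,5) by simp
qed

end

section \<open>Walks outside a feedback vertex set\<close>

lemma feedback_number_attained:
  assumes "signed_digraph G"
  shows "\<exists>I. feedback_vertex_set G I \<and> card I = feedback_number G"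
proof -
  have "feedback_vertex_set G (vertices G)"
    unfolding feedback_vertex_set_def pre_digraph.cycle_def pre_digraph.awalk_def by simp
  then show ?thesis unfolding feedback_number_def
    by (intro LeastI[of "\<lambda>k. \<exists>I. feedback_vertex_set G I \<and> card I = k" "card (vertices G)"]) blast
qed

lemma (in wf_digraph) no_cycle_imp_acyclic_arcs_ends:
  assumes "\<nexists>p. cycle p"
  shows "acyclic (arcs_ends G)"
proof (rule acyclicI, intro allI notI)
  fix v assume "v \<rightarrow>\<^sup>+ v"
  then obtain p where "awalk v p v" "p \<noteq> []" using reachable1_awalk by blast
  then have "closed_w p" unfolding closed_w_def by auto
  then show False using closed_w_imp_cycle assms by blast
qed

lemma (in wf_digraph) no_cycle_imp_distinct_awalk_verts:
  assumes "\<nexists>p. cycle p" and "awalk u p v"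
  shows "distinct (awalk_verts u p)"
proof (rule ccontr)
  assume "\<not> distinct (awalk_verts u p)"
  then obtain r where "closed_w r"
    using awalk_not_distinct_decomp[OF assms(2)] unfolding closed_w_def by blast
  then show False using closed_w_imp_cycle assms(1) by blast
qed

lemma (in wf_digraph) awalk_snocI:
  assumes "awalk u p (tail G e)" "e \<in> arcs G"
  shows "awalk u (p @ [e]) (head G e)"
  using assms(1) arc_implies_awalk[OF assms(2)] by (rule awalk_appendI)

lemma (in wf_digraph) awalk_verts_eq_heads:
  assumes "awalk u p v"
  shows "awalk_verts u p = u # map (head G) p"
  using assms by (induction p arbitrary: u) (auto simp: awalk_Cons_iff)

lemma wf_digraph_digraph_of: "signed_digraph G \<Longrightarrow> wf_digraph (digraph_of G)"
  by unfold_locales (auto simp: digraph_of_def signed_digraph_def)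

lemma digraph_of_simps [simp]:
  "verts (digraph_of G) = vertices G" "arcs (digraph_of G) = sarcs G"
  "tail (digraph_of G) = fst" "head (digraph_of G) = fst \<circ> snd"
  by (simp_all add: digraph_of_def)

lemma walk_sign_simps [simp]:
  "walk_sign [] = 1" "walk_sign (p @ q) = walk_sign p * walk_sign q" "walk_sign [(j, i, s)] = s"
  by (simp_all add: walk_sign_def)

definition linked :: "'v signed_graph \<Rightarrow> 'v set \<Rightarrow> 'v \<Rightarrow> 'v \<Rightarrow> int \<Rightarrow> bool" where
  "linked G W j i s \<longleftrightarrow>
     (if j = i then \<exists>p. linking_cycle G W j p \<and> walk_sign p = s
      else \<exists>p. linking_path G W j p i \<and> walk_sign p = s)"

lemma embedded_H2I:
  assumes "a \<noteq> b" "{a, b} \<subseteq> vertices G"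
    and "\<And>s. s \<in> {1, -1} \<Longrightarrow> linked G {a, b} a a s" "linked G {a, b} b b 1"
    and "\<And>s. s \<in> {1, -1} \<Longrightarrow> linked G {a, b} a b s"
    and "\<And>s. s \<in> {1, -1} \<Longrightarrow> linked G {a, b} b a s"
  shows "embedded H2 G"
proof -
  define \<phi> where "\<phi> = (\<lambda>n::nat. if n = 1 then a else b)"
  have \<phi>: "\<phi> 1 = a" "\<phi> 2 = b" by (simp_all add: \<phi>_def)
  then have image: "\<phi> ` vertices H2 = {a, b}" by (simp add: H2_def)
  have "linked G {a, b} (\<phi> j) (\<phi> i) s \<and> (\<phi> j = \<phi> i \<longleftrightarrow> j = i)" if "(j, i, s) \<in> sarcs H2" for j i s
    using that assms \<phi> unfolding H2_def by auto
  then show ?thesis unfolding embedded_def image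
    using assms(1,2) image \<phi> by (intro exI[of _ \<phi>]) (fastforce simp: linked_def inj_on_def H2_def)
qed

locale feedback_digraph =
  fixes G :: "'v signed_graph" and I :: "'v set"
  assumes signed: "signed_digraph G" and feedback: "feedback_vertex_set G I"
begin

abbreviation U :: "'v set" where "U \<equiv> vertices G - I"

abbreviation free_arcs :: "('v \<times> 'v) set" where
  "free_arcs \<equiv> arcs_ends (digraph_of G \<restriction> U)"

sublocale D: wf_digraph "digraph_of G"
  using signed by (rule wf_digraph_digraph_of)

sublocale Free: wf_digraph "digraph_of G \<restriction> U"
  by (rule D.wellformed_induce_subgraph)

lemma finite_vertices: "finite (vertices G)"
  using signed by (simp add: signed_digraph_def)

lemma feedback_subset: "I \<subseteq> vertices G"
  using feedback by (simp add: feedback_vertex_set_def)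

lemma no_free_cycle: "\<nexists>p. Free.cycle p"
  using feedback by (simp add: feedback_vertex_set_def)

lemma free_arcsI: "(j, k, s) \<in> sarcs G \<Longrightarrow> j \<in> U \<Longrightarrow> k \<in> U \<Longrightarrow> (j, k) \<in> free_arcs"
  unfolding arcs_ends_def arc_to_ends_def by force

lemma finite_free_arcs: "finite free_arcs"
proof -
  have "finite (vertices G \<times> vertices G \<times> {-1, 1 :: int})" using finite_vertices by simp
  then have "finite (sarcs G)" using signed finite_subset unfolding signed_digraph_def by blast
  then show ?thesis by (simp add: arcs_ends_def)
qed

lemma acyclic_free_arcs: "acyclic free_arcs"
  using no_free_cycle by (rule Free.no_cycle_imp_acyclic_arcs_ends)

definition free_walk :: "'v \<Rightarrow> 'v \<Rightarrow> int \<Rightarrow> bool" where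
  "free_walk j k s \<longleftrightarrow>
     (\<exists>p. D.awalk j p k \<and> set (map (fst \<circ> snd) p) \<subseteq> U \<and> walk_sign p = s)"

lemma free_walk_refl: "j \<in> vertices G \<Longrightarrow> free_walk j j 1"
  unfolding free_walk_def by (intro exI[of _ "[]"]) (simp add: D.awalk_Nil_iff)

lemma free_walk_step:
  assumes "free_walk j k s" "(k, l, t) \<in> sarcs G" "l \<in> U"
  shows "free_walk j l (s * t)"
proof -
  obtain p where "D.awalk j p k" "set (map (fst \<circ> snd) p) \<subseteq> U" "walk_sign p = s"
    using assms(1) unfolding free_walk_def by blast
  then show ?thesis unfolding free_walk_def
    using D.awalk_snocI[of j p "(k, l, t)"] assms(2,3)
    by (intro exI[of _ "p @ [(k, l, t)]"]) auto
qed

lemma distinct_free_walk_heads: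
  assumes p: "D.awalk j p k" and U: "set (map (fst \<circ> snd) p) \<subseteq> U"
  shows "distinct (map (fst \<circ> snd) p)"
proof (cases p)
  case (Cons e q)
  let ?h = "(fst \<circ> snd) e"
  have q: "D.awalk ?h q k" using p unfolding Cons by (simp add: D.awalk_Cons_iff)
  then have verts: "D.awalk_verts ?h q = map (fst \<circ> snd) p"
    using D.awalk_verts_eq_heads unfolding Cons by simp
  then have "Free.awalk ?h q k" using q U by (intro D.awalk_induce) simp_all
  then have "distinct (Free.awalk_verts ?h q)"
    by (rule Free.no_cycle_imp_distinct_awalk_verts[OF no_free_cycle])
  then show ?thesis unfolding D.awalk_verts_induce verts .
qed simp

lemma free_walk_imp_linked:
  assumes "free_walk j k s" and arc: "(k, i, t) \<in> sarcs G" and j: "j \<in> I" and i: "i \<in> I"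
  shows "linked G I j i (s * t)"
proof -
  obtain p where p: "D.awalk j p k" "set (map (fst \<circ> snd) p) \<subseteq> U" "walk_sign p = s"
    using assms(1) unfolding free_walk_def by blast
  define q where "q = p @ [(k, i, t)]"
  have q: "D.awalk j q i"
    using D.awalk_snocI[of j p "(k, i, t)"] p(1) arc by (simp add: q_def)
  have verts: "D.awalk_verts j q = j # map (fst \<circ> snd) p @ [i]"
    using D.awalk_verts_eq_heads[OF q] by (simp add: q_def)
  have sign: "walk_sign q = s * t" using p(3) by (simp add: q_def)
  have tl_distinct: "distinct (map (fst \<circ> snd) p @ [i])"
    using distinct_free_walk_heads[OF p(1,2)] p(2) i by auto
  show ?thesis
  proof (cases "j = i")
    case True
    have "map fst q = j # map (fst \<circ> snd) p"
      using D.awalk_verts_conv[of j q] verts by (auto simp: q_def)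
    then have "fst ` set q = insert j (set (map (fst \<circ> snd) p))"
      by (metis list.set_map list.simps(15))
    moreover have "D.cycle q" unfolding D.cycle_def
      using q True verts tl_distinct by (intro exI[of _ j]) (auto simp: q_def)
    ultimately have "linking_cycle G I j q" unfolding linking_cycle_def using p(2) by blast
    then show ?thesis using sign True unfolding linked_def by auto
  next
    case False
    then have "D.apath j q i"
      using q tl_distinct verts p(2) j unfolding D.apath_def by auto
    then have "linking_path G I j q i" unfolding linking_path_def verts using p(2) by auto
    then show ?thesis using sign False unfolding linked_def by auto
  qed
qed

end

section \<open>Configurations stable outside a feedback vertex set\<close>

locale feedback_network = boolean_network G f + feedback_digraph G I
  for G :: "'v signed_graph" and f :: "('v \<Rightarrow> int) \<Rightarrow> ('v \<Rightarrow> int)" and I :: "'v set"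
begin

definition free_stable :: "('v \<Rightarrow> int) \<Rightarrow> bool" where
  "free_stable x \<longleftrightarrow> x \<in> configs V \<and> (\<forall>k \<in> U. f x k = x k)"

lemma free_stable_configs: "free_stable x \<Longrightarrow> x \<in> configs V"
  by (simp add: free_stable_def)

lemma free_stable_unique:
  assumes x: "free_stable x" and y: "free_stable y" and agree: "\<And>i. i \<in> I \<Longrightarrow> y i = x i"
  shows "y = x"
proof (rule configs_eqI[OF free_stable_configs[OF y] free_stable_configs[OF x]])
  fix k assume "k \<in> V"
  with finite_acyclic_wf[OF finite_free_arcs acyclic_free_arcs] show "y k = x k"
  proof (induction k rule: wf_induct_rule)
    case (less k)
    show ?case
    proof (rule ccontr)
      assume neq: "y k \<noteq> x k"
      then have k: "k \<in> U" using agree less.prems by blast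
      then have "f y k \<noteq> f x k" using x y neq by (simp add: free_stable_def)
      then obtain l s where l: "l \<in> V" "y l \<noteq> x l" "(l, k, s) \<in> sarcs G"
        using changes_imp_arc[OF finite_vertices free_stable_configs[OF x] free_stable_configs[OF y]]
          less.prems by blast
      then have "(l, k) \<in> free_arcs" using agree k by (intro free_arcsI) auto
      then show False using less.IH l by blast
    qed
  qed
qed

lemma update_no_arc:
  assumes "x \<in> configs V" "k \<in> V" "i \<in> V" "\<And>s. (k, i, s) \<notin> sarcs G"
  shows "f (x(k := f x k)) i = f x i"
  using fun_upd_changes_imp_arc[OF assms(1-3)] network_values[OF assms(1,2)] assms(4) by blast

text \<open>Updating \<open>W\<close> along a topological order: the last vertex of \<open>W\<close> influences no vertex
  of \<open>W\<close>.\<close>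

lemma update_closed_stable_on:
  assumes closed: "A \<subseteq> configs V" "\<And>v k. v \<in> A \<Longrightarrow> k \<in> U \<Longrightarrow> v(k := f v k) \<in> A"
    and x: "x \<in> A" and W: "W \<subseteq> U"
  shows "\<exists>v \<in> A. (\<forall>i \<in> I. v i = x i) \<and> (\<forall>k \<in> W. f v k = v k)"
proof -
  have "finite W" using W finite_vertices finite_subset by blast
  then show ?thesis using W
  proof (induction W rule: finite_psubset_induct)
    case (psubset W)
    show ?case
    proof (cases "W = {}")
      case True
      then show ?thesis using x by auto
    next
      case False
      obtain k where k: "k \<in> W" "\<And>l. (k, l) \<in> free_arcs \<Longrightarrow> l \<notin> W"
        using finite_acyclic_wf_converse[OF finite_free_arcs acyclic_free_arcs] False
        by (rule wfE_min') auto
      then obtain v where v: "v \<in> A" "\<forall>i \<in> I. v i = x i" "\<forall>l \<in> W - {k}. f v l = v l"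
        using psubset.IH[of "W - {k}"] psubset.prems by blast
      let ?w = "v(k := f v k)"
      have kU: "k \<in> U" using k(1) psubset.prems by blast
      have "f ?w l = ?w l" if l: "l \<in> W" for l
      proof -
        have "(k, l, s) \<notin> sarcs G" for s using k(2) l kU psubset.prems free_arcsI by blast
        then have "f ?w l = f v l"
          using closed(1) v(1) kU l psubset.prems by (intro update_no_arc) auto
        then show ?thesis using v(3) l by simp
      qed
      moreover have "?w i = x i" if "i \<in> I" for i using that v(2) kU by auto
      ultimately show ?thesis using closed(2)[OF v(1) kU] by blast
    qed
  qed
qed

lemma update_closed_free_stable:
  assumes "A \<subseteq> configs V" "\<And>v k. v \<in> A \<Longrightarrow> k \<in> U \<Longrightarrow> v(k := f v k) \<in> A" "x \<in> A"
  shows "\<exists>v \<in> A. free_stable v \<and> (\<forall>i \<in> I. v i = x i)"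
  using update_closed_stable_on[OF assms, of U] assms(1) unfolding free_stable_def by blast

lemma attractor_free_stable:
  assumes "attractor V f A" "x \<in> A"
  shows "\<exists>v \<in> A. free_stable v \<and> (\<forall>i \<in> I. v i = x i)"
  using assms by (intro update_closed_free_stable) (auto simp: attractor_subset_configs attractor_update)

lemma attractors_differ_on_feedback:
  assumes A: "attractor V f A" and B: "attractor V f B" and "A \<noteq> B" "x \<in> A" "y \<in> B"
  shows "\<exists>i \<in> I. x i \<noteq> y i"
proof (rule ccontr)
  assume agree: "\<not> (\<exists>i \<in> I. x i \<noteq> y i)"
  obtain v where v: "v \<in> A" "free_stable v" "\<forall>i \<in> I. v i = x i"
    using attractor_free_stable[OF A \<open>x \<in> A\<close>] by blast
  obtain w where w: "w \<in> B" "free_stable w" "\<forall>i \<in> I. w i = y i"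
    using attractor_free_stable[OF B \<open>y \<in> B\<close>] by blast
  have "w = v" using v w agree by (intro free_stable_unique) auto
  then show False using attractors_disjoint[OF A B \<open>A \<noteq> B\<close>] v(1) w(1) by blast
qed

text \<open>The sign of the walk is the one that turns the change \<open>spin (x j)\<close> of \<open>j\<close> into the change
  \<open>spin (x k)\<close> of \<open>k\<close>; meanwhile \<open>j\<close> itself may have changed back.\<close>

definition perturbed :: "'v \<Rightarrow> ('v \<Rightarrow> int) \<Rightarrow> ('v \<Rightarrow> int) \<Rightarrow> bool" where
  "perturbed j x v \<longleftrightarrow> v \<in> configs V \<and>
     (\<forall>k \<in> V. v k \<noteq> x k \<longrightarrow> k \<in> insert j U \<and> free_walk j k (spin (x j) * spin (x k)))"

lemma perturbed_configs: "perturbed j x v \<Longrightarrow> v \<in> configs V"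
  by (simp add: perturbed_def)

lemma perturbed_refl: "x \<in> configs V \<Longrightarrow> perturbed j x x"
  by (simp add: perturbed_def)

lemma perturbed_fixes_feedback:
  assumes "perturbed j x v" "i \<in> I" "i \<noteq> j"
  shows "v i = x i"
  using assms feedback_subset unfolding perturbed_def by auto

lemma free_walk_self:
  "x \<in> configs V \<Longrightarrow> j \<in> V \<Longrightarrow> free_walk j j (spin (x j) * spin (x j))"
  by (simp add: configs_spin_square free_walk_refl)

lemma perturbed_change:
  assumes x: "x \<in> configs V" and v: "perturbed j x v" and i: "i \<in> V" and neq: "f v i \<noteq> f x i"
  obtains k s t where "free_walk j k s" "(k, i, t) \<in> sarcs G" "s * t = spin (x j) * spin (f x i)"
proof -
  obtain k where k: "k \<in> V" "v k \<noteq> x k" "(k, i, spin (x k) * spin (f x i)) \<in> sarcs G"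
    using changes_imp_arc[OF finite_vertices x perturbed_configs[OF v] i neq] by blast
  have "free_walk j k (spin (x j) * spin (x k))" using v k by (simp add: perturbed_def)
  moreover have "spin (x j) * spin (x k) * (spin (x k) * spin (f x i)) = spin (x j) * spin (f x i)"
    using configs_spin_square[OF x k(1)] by algebra
  ultimately show ?thesis using k(3) that by blast
qed

lemma perturbed_imp_linked:
  assumes "x \<in> configs V" "perturbed j x v" "j \<in> I" "i \<in> I" "f v i \<noteq> f x i"
  shows "linked G I j i (spin (x j) * spin (f x i))"
  using perturbed_change[OF assms(1,2) _ assms(5)] free_walk_imp_linked[OF _ _ assms(3,4)]
    feedback_subset assms(4) by (metis subsetD)

lemma perturbed_update:
  assumes x: "free_stable x" and v: "perturbed j x v" and j: "j \<in> V" and k: "k \<in> insert j U"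
  shows "perturbed j x (v(k := f v k))"
proof -
  have xV: "x \<in> configs V" and vV: "v \<in> configs V"
    using free_stable_configs[OF x] perturbed_configs[OF v] .
  have kV: "k \<in> V" using j k by blast
  have "free_walk j k (spin (x j) * spin (x k))" if neq: "f v k \<noteq> x k"
  proof (cases "k = j")
    case True
    then show ?thesis using free_walk_self[OF xV j] by simp
  next
    case False
    then have kU: "k \<in> U" and fixed: "f x k = x k" using k x by (auto simp: free_stable_def)
    then have "f v k \<noteq> f x k" using neq by simp
    then obtain l s t where "free_walk j l s" "(l, k, t) \<in> sarcs G"
      "s * t = spin (x j) * spin (f x k)"
      by (rule perturbed_change[OF xV v kV])
    then show ?thesis using free_walk_step kU fixed by metis
  qed
  moreover have "v(k := f v k) \<in> configs V"
    using vV kV network_values[OF vV kV] by (rule configs_fun_upd)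
  ultimately show ?thesis using v k unfolding perturbed_def by auto
qed

lemma perturbed_free_stable:
  assumes x: "free_stable x" and y: "free_stable y" and j: "j \<in> I"
    and agree: "\<And>i. i \<in> I \<Longrightarrow> i \<noteq> j \<Longrightarrow> y i = x i"
  shows "perturbed j x y"
proof -
  have jV: "j \<in> V" using j feedback_subset by blast
  have xV: "x \<in> configs V" and "y \<in> configs V"
    using x y by (simp_all add: free_stable_configs)
  then have "x(j := y j) \<in> configs V"
    using jV by (intro configs_fun_upd configs_values)
  then have "x(j := y j) \<in> {v. perturbed j x v}"
    using free_walk_self[OF xV jV] by (auto simp: perturbed_def)
  then obtain w where w: "perturbed j x w" "free_stable w" "\<forall>i \<in> I. w i = (x(j := y j)) i"
    using update_closed_free_stable[of "{v. perturbed j x v}"] perturbed_update[OF x _ jV]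
      perturbed_configs by blast
  have "y = w" using w agree by (intro free_stable_unique[OF w(2) y]) auto
  then show ?thesis using w(1) by simp
qed

text \<open>Configurations of \<open>B\<close> reached by updating only \<open>j\<close> and vertices outside \<open>I\<close> would form a
  smaller trap set if they never required an update of another element of \<open>I\<close>.\<close>

lemma attractor_leaves_perturbed:
  assumes B: "attractor V f B" and x: "x \<in> B" "free_stable x" and j: "j \<in> V"
    and y: "y \<in> B" "i \<in> I" "i \<noteq> j" "y i \<noteq> x i"
  shows "\<exists>v \<in> B. perturbed j x v \<and> (\<exists>l \<in> I - {j}. f v l \<noteq> v l)"
proof (rule ccontr)
  assume none: "\<not> ?thesis"
  let ?S = "{v \<in> B. perturbed j x v}"
  have "v(k := f v k) \<in> ?S" if v: "v \<in> ?S" and k: "k \<in> V" for v k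
  proof (cases "k \<in> insert j U")
    case True
    then show ?thesis using v perturbed_update[OF x(2) _ j] attractor_update[OF B _ k] by blast
  next
    case False
    then have "f v k = v k" using none v k by blast
    then show ?thesis using v by simp
  qed
  then have "trap_set V f ?S"
    using attractor_subset_configs[OF B] unfolding trap_set_iff_update by blast
  moreover have "x \<in> ?S" using x perturbed_refl free_stable_configs by auto
  ultimately have "?S = B" using B by (intro attractor_minimal) auto
  then have "perturbed j x y" using y(1) by auto
  from perturbed_fixes_feedback[OF this y(2,3)] y(4) show False by simp
qed

end

section \<open>A fixed point beside an attractor\<close>

locale fixed_point_beside_attractor = feedback_network G f I
  for G :: "'v signed_graph" and f :: "('v \<Rightarrow> int) \<Rightarrow> ('v \<Rightarrow> int)" and I :: "'v set" +
  fixes a b :: 'v and u :: "'v \<Rightarrow> int" and B :: "('v \<Rightarrow> int) set"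
  assumes feedback_pair: "I = {a, b}" "a \<noteq> b"
    and fixed_point: "u \<in> configs V" "\<And>k. k \<in> V \<Longrightarrow> f u k = u k"
    and attractor_B: "attractor V f B" and fixed_point_notin: "u \<notin> B"
    and meets_a: "\<exists>x \<in> B. x a = u a" and meets_b: "\<exists>y \<in> B. y b = u b"
begin

lemma swap: "fixed_point_beside_attractor G f I b a u B"
  using feedback_pair fixed_point attractor_B fixed_point_notin meets_a meets_b
  by unfold_locales auto

lemma pair_vertices: "a \<in> V" "b \<in> V"
  using feedback_subset feedback_pair by auto

lemma attractor_configs: "v \<in> B \<Longrightarrow> v \<in> configs V"
  using attractor_subset_configs[OF attractor_B] by blast

lemma fixed_point_free_stable: "free_stable u"
  using fixed_point by (simp add: free_stable_def)

lemma attractor_avoids_corner: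
  assumes "v \<in> B"
  shows "v a \<noteq> u a \<or> v b \<noteq> u b"
proof (rule ccontr)
  assume agree: "\<not> ?thesis"
  obtain w where w: "w \<in> B" "free_stable w" "\<forall>i \<in> I. w i = v i"
    using attractor_free_stable[OF attractor_B assms] by blast
  then have "w = u"
    using agree feedback_pair by (intro free_stable_unique fixed_point_free_stable) auto
  then show False using w(1) fixed_point_notin by blast
qed

lemma attractor_stays_on_edge:
  assumes v: "v \<in> B" "v a = u a"
  shows "v b \<noteq> u b" "f v b \<noteq> u b"
proof -
  show "v b \<noteq> u b" using attractor_avoids_corner[OF v(1)] v(2) by blast
  have "v(b := f v b) \<in> B" using attractor_update[OF attractor_B v(1) pair_vertices(2)] .
  then show "f v b \<noteq> u b" using attractor_avoids_corner v(2) feedback_pair(2) by fastforce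
qed

lemma free_stable_moves:
  assumes v: "v \<in> B" "free_stable v"
  shows "f v a \<noteq> v a \<or> f v b \<noteq> v b"
proof (rule ccontr)
  assume "\<not> ?thesis"
  then have "f v k = v k" if "k \<in> V" for k
    using that v(2) feedback_pair(1) unfolding free_stable_def by (cases "k \<in> I") auto
  then have "B = {v}" using attractor_fixed_point[OF attractor_B v(1)] by blast
  then show False using meets_a meets_b attractor_avoids_corner[OF v(1)] by simp
qed

lemma edge_free_stable:
  obtains x where "x \<in> B" "free_stable x" "x a = u a" "x b \<noteq> u b" "f x a \<noteq> u a" "f x b \<noteq> u b"
proof -
  obtain x where x: "x \<in> B" "free_stable x" "x a = u a"
    using meets_a attractor_free_stable[OF attractor_B] feedback_pair(1) by (metis insertI1)
  note edge = attractor_stays_on_edge[OF x(1,3)]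
  have xV: "x \<in> configs V" using x(1) by (rule attractor_configs)
  have "f x b = x b"
    using configs_neq_neq_imp_eq[OF network_configs[OF xV] fixed_point(1) xV pair_vertices(2)] edge
    by metis
  then have "f x a \<noteq> u a" using free_stable_moves[OF x(1,2)] x(3) by simp
  then show ?thesis using that x edge by blast
qed

lemma linked_from_fixed_point:
  assumes "i \<in> I"
  shows "linked G I b i (spin (u b) * spin (u i))"
proof -
  obtain x where x: "free_stable x" "x a = u a" "f x a \<noteq> u a" "f x b \<noteq> u b"
    using edge_free_stable by blast
  have "perturbed b u x"
    using x(1,2) feedback_pair by (intro perturbed_free_stable fixed_point_free_stable) auto
  moreover have "i \<in> V" using assms feedback_subset by blast
  moreover have "f x i \<noteq> u i" using assms x(3,4) feedback_pair(1) by auto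
  ultimately show ?thesis
    using perturbed_imp_linked[OF fixed_point(1), of b x i] assms fixed_point(2) feedback_pair(1)
    by simp
qed

lemma attractor_leaves_edge:
  obtains x v where "x \<in> B" "x a = u a" "f x b \<noteq> u b" "perturbed a x v"
    "v \<in> B" "v a \<noteq> u a" "v b \<noteq> u b" "f v b = u b"
proof -
  obtain x where x: "x \<in> B" "free_stable x" "x a = u a" "x b \<noteq> u b" "f x b \<noteq> u b"
    using edge_free_stable by blast
  obtain y where y: "y \<in> B" "y b = u b" using meets_b by blast
  have "b \<in> I" "b \<noteq> a" "y b \<noteq> x b" using feedback_pair x(4) y(2) by auto
  then obtain v where v: "v \<in> B" "perturbed a x v" "f v b \<noteq> v b"
    using attractor_leaves_perturbed[OF attractor_B x(1,2) pair_vertices(1) y(1)] feedback_pair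
    by auto
  have vV: "v \<in> configs V" using v(1) by (rule attractor_configs)
  have vb: "v b \<noteq> u b" using perturbed_fixes_feedback[OF v(2)] feedback_pair x(4) by auto
  then have fvb: "f v b = u b"
    using configs_neq_neq_imp_eq[OF network_configs[OF vV] vV fixed_point(1) pair_vertices(2)] v(3)
    by blast
  then have "v a \<noteq> u a" using attractor_stays_on_edge(2)[OF v(1)] by blast
  then show ?thesis using that x(1,3,5) v(1,2) vb fvb by blast
qed

lemma linked_from_edge: "linked G I a b (- (spin (u a) * spin (u b)))"
proof -
  obtain x v where x: "x \<in> B" "x a = u a" "f x b \<noteq> u b"
    and v: "perturbed a x v" "f v b = u b"
    using attractor_leaves_edge by blast
  have xV: "x \<in> configs V" using x(1) by (rule attractor_configs)
  have "linked G I a b (spin (x a) * spin (f x b))"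
    using x(3) v feedback_pair(1) by (intro perturbed_imp_linked[OF xV]) auto
  moreover have "spin (f x b) = - spin (u b)"
    using configs_spin_neq[OF network_configs[OF xV] fixed_point(1) pair_vertices(2) x(3)] .
  ultimately show ?thesis using x(2) by simp
qed

lemma linked_both_signs:
  assumes "s \<in> {1, -1}"
  shows "linked G I a b s"
proof -
  interpret swap: fixed_point_beside_attractor G f I b a u B by (rule swap)
  have "spin (u a) \<in> {1, -1}" "spin (u b) \<in> {1, -1}"
    using configs_spin_values[OF fixed_point(1)] pair_vertices by blast+
  then have "s = spin (u a) * spin (u b) \<or> s = - (spin (u a) * spin (u b))"
    using assms by auto
  then show ?thesis
    using linked_from_edge swap.linked_from_fixed_point feedback_pair(1) by auto
qed

lemma linked_positive_loop: "linked G I b b 1"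
  using linked_from_fixed_point[of b] configs_spin_square[OF fixed_point(1) pair_vertices(2)]
    feedback_pair(1) by simp

lemma linked_negative_loop:
  assumes w: "w \<in> B" "free_stable w" "w a \<noteq> u a" "w b \<noteq> u b" "f w a \<noteq> w a"
  shows "linked G I a a (-1)"
proof -
  obtain x where x: "x \<in> B" "free_stable x" "x a = u a" "x b \<noteq> u b" "f x a \<noteq> u a"
    using edge_free_stable by blast
  have wV: "w \<in> configs V" and xV: "x \<in> configs V"
    using w(1) x(1) by (simp_all add: attractor_configs)
  have "w b = x b"
    using configs_neq_neq_imp_eq[OF wV fixed_point(1) xV pair_vertices(2)] w(4) x(4) by metis
  then have "perturbed a x w"
    using w(2) x(2) feedback_pair by (intro perturbed_free_stable) auto
  moreover have "f w a = u a"
    using configs_neq_neq_imp_eq[OF network_configs[OF wV] wV fixed_point(1) pair_vertices(1)] w(3,5)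
    by blast
  ultimately have "linked G I a a (spin (x a) * spin (f x a))"
    using x(5) feedback_pair(1) by (intro perturbed_imp_linked[OF xV]) auto
  moreover have "spin (f x a) = - spin (u a)"
    using configs_spin_neq[OF network_configs[OF xV] fixed_point(1) pair_vertices(1) x(5)] .
  ultimately show ?thesis
    using x(3) configs_spin_square[OF fixed_point(1) pair_vertices(1)] by simp
qed

lemma embedded_H2_if_negative_loop:
  assumes "linked G I a a (-1)"
  shows "embedded H2 G"
proof -
  interpret swap: fixed_point_beside_attractor G f I b a u B by (rule swap)
  show ?thesis
    using assms swap.linked_positive_loop linked_positive_loop linked_both_signs
      swap.linked_both_signs feedback_pair pair_vertices
    by (intro embedded_H2I[of a b]) auto
qed

lemma embedded_H2: "embedded H2 G"
proof -
  interpret swap: fixed_point_beside_attractor G f I b a u B by (rule swap)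
  obtain v where v: "v \<in> B" "v a \<noteq> u a" "v b \<noteq> u b" using attractor_leaves_edge by blast
  then obtain w where w: "w \<in> B" "free_stable w" "w a \<noteq> u a" "w b \<noteq> u b"
    using attractor_free_stable[OF attractor_B v(1)] feedback_pair(1) by auto
  from free_stable_moves[OF w(1,2)] show ?thesis
  proof
    assume "f w a \<noteq> w a"
    then show ?thesis using linked_negative_loop[OF w] embedded_H2_if_negative_loop by blast
  next
    assume "f w b \<noteq> w b"
    then show ?thesis
      using swap.linked_negative_loop[OF w(1,2,4,3)] swap.embedded_H2_if_negative_loop by blast
  qed
qed

end

context feedback_network
begin

lemma attractor_coordinate_fixed:
  assumes A: "attractor V f A" and B: "attractor V f B" and AB: "A \<noteq> B"
    and I: "I = {i, j}" "i \<noteq> j" and u: "u \<in> A" and y: "y \<in> B" "y j = u j"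
  shows "f u i = u i"
proof (rule ccontr)
  assume neq: "f u i \<noteq> u i"
  have i: "i \<in> V" using I(1) feedback_subset by blast
  have uV: "u \<in> configs V" and yV: "y \<in> configs V"
    using A B u y(1) attractor_subset_configs by blast+
  have "y i \<noteq> u i" using attractors_differ_on_feedback[OF A B AB u y(1)] I(1) y(2) by auto
  then have "f u i = y i"
    using configs_neq_neq_imp_eq[OF network_configs[OF uV] uV yV i neq] by metis
  moreover have "u(i := f u i) \<in> A" using A u i by (rule attractor_update)
  ultimately show False
    using attractors_differ_on_feedback[OF A B AB _ y(1)] I y(2) by fastforce
qed

lemma three_corners_imp_embedded_H2:
  assumes A: "attractor V f A" and B: "attractor V f B" and AB: "A \<noteq> B"
    and I: "I = {a, b}" "a \<noteq> b"
    and p: "p \<in> A" and x: "x \<in> B" "x a = p a" and y: "y \<in> B" "y b = p b"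
  shows "embedded H2 G"
proof -
  obtain u where u: "u \<in> A" "free_stable u" "\<forall>i \<in> I. u i = p i"
    using attractor_free_stable[OF A p] by blast
  then have agree: "x a = u a" "y b = u b" using I(1) x(2) y(2) by simp_all
  have "f u a = u a" using attractor_coordinate_fixed[OF A B AB I u(1) y(1) agree(2)] .
  moreover have "f u b = u b"
    using attractor_coordinate_fixed[OF A B AB _ _ u(1) x(1) agree(1)] I by blast
  ultimately have "f u k = u k" if "k \<in> V" for k
    using that u(2) I(1) unfolding free_stable_def by (cases "k \<in> I") auto
  moreover have "u \<notin> B" using attractors_disjoint[OF A B AB] u(1) by blast
  ultimately interpret fixed_point_beside_attractor G f I a b u B
    using I B free_stable_configs[OF u(2)] x(1) y(1) agree by unfold_locales auto
  show ?thesis by (rule embedded_H2)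
qed

lemma meeting_hulls_imp_embedded_H2:
  assumes A: "attractor V f A" and B: "attractor V f B" and AB: "A \<noteq> B"
    and meet: "subspace_hull V A \<inter> subspace_hull V B \<noteq> {}" and I: "I = {a, b}" "a \<noteq> b"
  shows "embedded H2 G"
proof -
  have V: "a \<in> V" "b \<in> V" using I feedback_subset by auto
  have ne: "A \<noteq> {}" "B \<noteq> {}" using A B by (simp_all add: attractor_def)
  note sub = attractor_subset_configs[OF A] attractor_subset_configs[OF B]
  obtain x y where x: "x \<in> A" and y: "y \<in> B" and xy: "x a = y a"
    using subspace_hulls_meet_coordinate[OF ne(1) sub(1) ne(2) sub(2) meet V(1)] by blast
  obtain x' y' where x': "x' \<in> A" and y': "y' \<in> B" and xy': "x' b = y' b"
    using subspace_hulls_meet_coordinate[OF ne(1) sub(1) ne(2) sub(2) meet V(2)] by blast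
  have "x b \<noteq> y b" using attractors_differ_on_feedback[OF A B AB x y] xy I(1) by auto
  then consider (A_corner) "x b = y' b" | (B_corner) "y b = x' b"
    using configs_neq_neq_imp_eq[of x V y x' b] x y x' sub V(2) xy' by (metis subsetD)
  then show ?thesis
  proof cases
    case A_corner
    then show ?thesis using three_corners_imp_embedded_H2[OF A B AB I x y _ y'] xy by simp
  next
    case B_corner
    then show ?thesis
      using three_corners_imp_embedded_H2[OF B A AB[symmetric] I y x _ x'] xy by simp
  qed
qed

end

theorem theorem46:
  fixes G :: "'v signed_graph"
  assumes "signed_digraph G"
    and "\<not> separating G"
    and "feedback_number G = 2"
  shows "embedded H2 G"
proof -
  obtain I where I: "feedback_vertex_set G I" "card I = 2"
    using feedback_number_attained[OF assms(1)] assms(3) by auto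
  then obtain a b where ab: "I = {a, b}" "a \<noteq> b" by (auto simp: card_2_iff)
  obtain f A B where f: "f \<in> networks_on G"
    and attractors: "attractor (vertices G) f A" "attractor (vertices G) f B" "A \<noteq> B"
    and meet: "subspace_hull (vertices G) A \<inter> subspace_hull (vertices G) B \<noteq> {}"
    using assms(2) unfolding separating_def by blast
  interpret feedback_network G f I
    using assms(1) f I(1) by unfold_locales
  show ?thesis using attractors meet ab by (rule meeting_hulls_imp_embedded_H2)
qed

end
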